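(* Let $\rho^k\nearrow\infty$ and let $(u^k,v^k,\tilde v^k)_k$ be a sequence generated by the Penalty-$\varepsilon$-ADM method (defined in the context) with penalty parameters $\rho^k$, such that $(u^k,v^k,\tilde v^k)\to(u^*,v^*,\tilde v^* )$ in $U_t\times V_t\times V_t$. Then $(u^*,v^*,\tilde v^* )$ is a p-minimum of the feasibility measure $$\chi(v,\tilde v)=\int_0^T|v(t)-\tilde v(t)|_{l_1}\,dt,$$ that is, $\chi(v,\tilde v^* )\ge\chi(v^*,\tilde v^* )$ for all $(u,v)\in\Sigma\times V_t$, and $\chi(v^*,\tilde v)\ge\chi(v^*,\tilde v^* )$ for all $\tilde v\in\Gamma$.
   Context: Setting: $T>0$, $M\in\mathbb{N}$, $p\in(0,\infty]$; $Y$ and $U$ are Banach spaces; $U_t=L^p(0,T;U)$, $V_t=L^\infty(0,T;\{0,1\}^M)$; $\Sigma\subset U_t$ and $\Gamma\subset V_t$ are given sets; $y_0\in Y$; $A$ is a densely defined linear operator on $Y$; $f\colon Y\times U\times\{0,1\}^M\to Y$; $|w|_{l_1}=\sum_{i=1}^M|w_i|$. Standing assumption: $A$ generates a strongly continuous semigroup $(e^{tA})_{t\ge0}$ on $Y$, and there is $K>0$ such that for all $v\in\{0,1\}^M$: (i) $(y,u)\mapsto f(y,u,v)$ is continuous on $Y\times U$; (ii) $\|f(y,u,v)\|_Y\le K(1+\|y\|_Y)$ for all $y\in Y$, $u\in U$; (iii) $\|f(y,u,v)-f(z,u,v)\|_Y\le K\|y-z\|_Y$ for all $y,z\in Y$,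 $u\in U$. Moreover $\Phi\colon Y\to\mathbb{R}$ is Lipschitz continuous on bounded subsets of $Y$. For $u\in U_t$, $v\in V_t$, $y(\cdot;u,v)\in C([0,T];Y)$ is the unique mild solution of $\dot y=Ay+f(y,u,v)$, $y(0)=y_0$, i.e. $y(t)=e^{tA}y_0+\int_0^te^{(t-\tau)A}f(y(\tau),u(\tau),v(\tau))\,d\tau$, and $\Psi(u,v):=\Phi(y(T;u,v))$. Penalty problem with parameter $\rho\ge0$: minimize $\Psi_\rho(u,v,\tilde v):=\Psi(u,v)+\rho\int_0^T|v(t)-\tilde v(t)|_{l_1}\,dt$ over $u\in\Sigma$, $v\in V_t$, $\tilde v\in\Gamma$. An $\frac{\varepsilon}{2}$-optimal solution of a minimization problem is a feasible point whose objective value is at most the objective value of every feasible point plus $\frac{\varepsilon}{2}$. Penalty-$\varepsilon$-ADM method, for a given $\varepsilon\ge0$: choose $(u^{(0,* )},v^{(0,* )},\tilde v^{(0,* )})\in\Sigma\times V_t\times\Gamma$ and $\rho^{1}=0$. For $k=1,2,3,\dots$: set $(u^{(k,0)},v^{(k,0)},\tilde v^{(k,0)})=(u^{(k-1,* )},v^{(k-1,* )},\tilde v^{(k-1,* )})$ and, for $l=0,1,2,\dots$, do the following. (1) For $\tilde v^{(k,l)}$ fixed, find an $\frac{\varepsilon}{2}$-optimal solution $(u^{(k,l+1)},v^{(k,l+1)})\in\Sigma\times V_t$ of the penalty problem with parameter $\rho^k$. (2) If $\Psi_{\rho^k}(u^{(k,l+1)},v^{(k,l+1)},\tilde v^{(k,l)})\ge\Psi_{\rho^k}(u^{(k,l)},v^{(k,l)},\tilde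 v^{(k,l)})-\frac{\varepsilon}{2}$, set $(u^{(k,* )},v^{(k,* )},\tilde v^{(k,* )})=(u^{(k,l)},v^{(k,l)},\tilde v^{(k,l)})$ and leave the inner loop. (3) For $(u^{(k,l+1)},v^{(k,l+1)})$ fixed, find an $\frac{\varepsilon}{2}$-optimal solution $\tilde v^{(k,l+1)}\in\Gamma$ of the penalty problem with parameter $\rho^k$. (4) If $\Psi_{\rho^k}(u^{(k,l+1)},v^{(k,l+1)},\tilde v^{(k,l+1)})\ge\Psi_{\rho^k}(u^{(k,l+1)},v^{(k,l+1)},\tilde v^{(k,l)})-\frac{\varepsilon}{2}$, set $(u^{(k,* )},v^{(k,* )},\tilde v^{(k,* )})=(u^{(k,l+1)},v^{(k,l+1)},\tilde v^{(k,l)})$ and leave the inner loop. After the inner loop, choose $\rho^{k+1}>\rho^k$. A sequence generated by the method is the sequence of outer iterates $(u^k,v^k,\tilde v^k):=(u^{(k,* )},v^{(k,* )},\tilde v^{(k,* )})$, where the inner loop terminates for every $k$. *)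

theory Defs
  imports "HOL-Analysis.Analysis" "HOL-Probability.Essential_Supremum"
begin

text \<open>
  The Bochner integral of the library is restricted to separable (second countable) target
  spaces. State and control spaces are arbitrary Banach spaces here, so the notion is restated
  with strong (Bochner) measurability in place of Borel measurability; for second countable
  targets and a complete measure it coincides with \<^const>\<open>has_bochner_integral\<close>.
\<close>

definition strongly_measurable :: "'a measure \<Rightarrow> ('a \<Rightarrow> 'b::real_normed_vector) \<Rightarrow> bool" where
  "strongly_measurable M g \<longleftrightarrow>
     (\<exists>s. (\<forall>i. simple_function M (s i)) \<and> (AE x in M. (\<lambda>i::nat. s i x) \<longlonglongrightarrow> g x))"

definition has_strong_integral ::
    "'a measure \<Rightarrow> ('a \<Rightarrow> 'b::real_normed_vector) \<Rightarrow> 'b \<Rightarrow> bool" where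
  "has_strong_integral M g x \<longleftrightarrow>
     strongly_measurable M g \<and>
     (\<exists>s. (\<forall>i::nat. Bochner_Integration.simple_bochner_integrable M (s i)) \<and>
          (\<lambda>i. \<integral>\<^sup>+ t. ennreal (norm (g t - s i t)) \<partial>M) \<longlonglongrightarrow> 0 \<and>
          (\<lambda>i. Bochner_Integration.simple_bochner_integral M (s i)) \<longlonglongrightarrow> x)"

text \<open>
  Elements of \<open>L\<^sup>p(0,T;X)\<close> are represented by functions; only their values for almost
  every \<open>t\<close> in \<open>(0,T)\<close> matter. For \<open>p < 1\<close> the norm below is only a
  quasi-norm. It is meaningful only on members of \<open>Lp_space p T\<close>.
\<close>

definition Lp_space :: "ennreal \<Rightarrow> real \<Rightarrow> (real \<Rightarrow> 'b::real_normed_vector) set" where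
  "Lp_space p T = {g. strongly_measurable (lebesgue_on {0<..<T}) g \<and>
     (if p = \<infinity> then esssup (lebesgue_on {0<..<T}) (\<lambda>t. ennreal (norm (g t))) < \<infinity>
      else (\<integral>\<^sup>+ t. ennreal (norm (g t) powr enn2real p) \<partial>lebesgue_on {0<..<T}) < \<infinity>)}"

definition Lp_norm :: "ennreal \<Rightarrow> real \<Rightarrow> (real \<Rightarrow> 'b::real_normed_vector) \<Rightarrow> real" where
  "Lp_norm p T g =
     (if p = \<infinity> then enn2real (esssup (lebesgue_on {0<..<T}) (\<lambda>t. ennreal (norm (g t))))
      else enn2real (\<integral>\<^sup>+ t. ennreal (norm (g t) powr enn2real p) \<partial>lebesgue_on {0<..<T})
             powr (1 / enn2real p))"

definition Lp_tendsto ::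
    "ennreal \<Rightarrow> real \<Rightarrow> (nat \<Rightarrow> real \<Rightarrow> 'b::real_normed_vector) \<Rightarrow> (real \<Rightarrow> 'b) \<Rightarrow> bool" where
  "Lp_tendsto p T g h \<longleftrightarrow> (\<lambda>k. Lp_norm p T (\<lambda>t. g k t - h t)) \<longlonglongrightarrow> 0"

definition binary_vecs :: "(real ^ 'm) set" where
  "binary_vecs = {w. \<forall>i. w $ i \<in> {0, 1}}"

definition binary_controls :: "real \<Rightarrow> (real \<Rightarrow> real ^ 'm) set" where
  "binary_controls T =
     {v \<in> Lp_space \<infinity> T. AE t in lebesgue_on {0<..<T}. v t \<in> binary_vecs}"

definition l1_norm :: "real ^ 'm \<Rightarrow> real" where
  "l1_norm w = (\<Sum>i\<in>UNIV. \<bar>w $ i\<bar>)"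

definition C0_semigroup :: "(real \<Rightarrow> 'y::real_normed_vector \<Rightarrow> 'y) \<Rightarrow> bool" where
  "C0_semigroup S \<longleftrightarrow>
     (\<forall>t\<ge>0. bounded_linear (S t)) \<and> (\<forall>y. S 0 y = y) \<and>
     (\<forall>s\<ge>0. \<forall>t\<ge>0. \<forall>y. S (s + t) y = S s (S t y)) \<and>
     (\<forall>y. continuous_on {0..} (\<lambda>t. S t y))"

text \<open>An unbounded operator is a pair of its domain \<open>D\<close> and a function \<open>A\<close>
  whose values outside \<open>D\<close> are irrelevant.\<close>

definition densely_defined_linear :: "'y::real_normed_vector set \<Rightarrow> ('y \<Rightarrow> 'y) \<Rightarrow> bool" where
  "densely_defined_linear D A \<longleftrightarrow>
     subspace D \<and> closure D = UNIV \<and>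
     (\<forall>x\<in>D. \<forall>y\<in>D. A (x + y) = A x + A y) \<and> (\<forall>c. \<forall>x\<in>D. A (c *\<^sub>R x) = c *\<^sub>R A x)"

definition generates ::
    "'y::real_normed_vector set \<Rightarrow> ('y \<Rightarrow> 'y) \<Rightarrow> (real \<Rightarrow> 'y \<Rightarrow> 'y) \<Rightarrow> bool" where
  "generates D A S \<longleftrightarrow>
     C0_semigroup S \<and>
     D = {y. \<exists>z. ((\<lambda>h. (S h y - y) /\<^sub>R h) \<longlongrightarrow> z) (at_right 0)} \<and>
     (\<forall>y\<in>D. ((\<lambda>h. (S h y - y) /\<^sub>R h) \<longlongrightarrow> A y) (at_right 0))"

definition is_mild_solution ::
    "real \<Rightarrow> (real \<Rightarrow> 'y \<Rightarrow> 'y) \<Rightarrow> ('y \<Rightarrow> 'u \<Rightarrow> real ^ 'm \<Rightarrow> 'y) \<Rightarrow> 'y::banach \<Rightarrow>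
     (real \<Rightarrow> 'u) \<Rightarrow> (real \<Rightarrow> real ^ 'm) \<Rightarrow> (real \<Rightarrow> 'y) \<Rightarrow> bool" where
  "is_mild_solution T S f y0 u v y \<longleftrightarrow>
     continuous_on {0..T} y \<and>
     (\<forall>t\<in>{0..T}. \<exists>I.
        has_strong_integral (lebesgue_on {0..t}) (\<lambda>\<tau>. S (t - \<tau>) (f (y \<tau>) (u \<tau>) (v \<tau>))) I \<and>
        y t = S t y0 + I)"

text \<open>Extensionality makes the function unique also outside \<open>[0,T]\<close>.\<close>

definition mild_solution ::
    "real \<Rightarrow> (real \<Rightarrow> 'y \<Rightarrow> 'y) \<Rightarrow> ('y \<Rightarrow> 'u \<Rightarrow> real ^ 'm \<Rightarrow> 'y) \<Rightarrow> 'y::banach \<Rightarrow>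
     (real \<Rightarrow> 'u) \<Rightarrow> (real \<Rightarrow> real ^ 'm) \<Rightarrow> (real \<Rightarrow> 'y)" where
  "mild_solution T S f y0 u v =
     (THE y. y \<in> extensional {0..T} \<and> is_mild_solution T S f y0 u v y)"

definition cost ::
    "real \<Rightarrow> (real \<Rightarrow> 'y \<Rightarrow> 'y) \<Rightarrow> ('y \<Rightarrow> 'u \<Rightarrow> real ^ 'm \<Rightarrow> 'y) \<Rightarrow> 'y::banach \<Rightarrow> ('y \<Rightarrow> real) \<Rightarrow>
     (real \<Rightarrow> 'u) \<Rightarrow> (real \<Rightarrow> real ^ 'm) \<Rightarrow> real" where
  "cost T S f y0 \<Phi> u v = \<Phi> (mild_solution T S f y0 u v T)"

definition feas_measure :: "real \<Rightarrow> (real \<Rightarrow> real ^ 'm) \<Rightarrow> (real \<Rightarrow> real ^ 'm) \<Rightarrow> real" where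
  "feas_measure T v w = integral\<^sup>L (lebesgue_on {0<..<T}) (\<lambda>t. l1_norm (v t - w t))"

definition penalty_cost ::
    "real \<Rightarrow> (real \<Rightarrow> 'y \<Rightarrow> 'y) \<Rightarrow> ('y \<Rightarrow> 'u \<Rightarrow> real ^ 'm \<Rightarrow> 'y) \<Rightarrow> 'y::banach \<Rightarrow> ('y \<Rightarrow> real) \<Rightarrow> real \<Rightarrow>
     (real \<Rightarrow> 'u) \<Rightarrow> (real \<Rightarrow> real ^ 'm) \<Rightarrow> (real \<Rightarrow> real ^ 'm) \<Rightarrow> real" where
  "penalty_cost T S f y0 \<Phi> \<rho> u v w = cost T S f y0 \<Phi> u v + \<rho> * feas_measure T v w"

definition near_optimal :: "real \<Rightarrow> 'a set \<Rightarrow> ('a \<Rightarrow> real) \<Rightarrow> 'a \<Rightarrow> bool" where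
  "near_optimal \<delta> X J x \<longleftrightarrow> x \<in> X \<and> (\<forall>x'\<in>X. J x \<le> J x' + \<delta>)"

text \<open>
  \<open>adm_inner J \<Sigma> V \<Gamma> \<epsilon> x z\<close>: some run of the inner loop for the objective
  \<open>J\<close>, started at the triple \<open>x\<close>, terminates with the triple \<open>z\<close>. The rules
  correspond to leaving the loop after the first half step, leaving it after the second half
  step, and continuing. Every choice of near-optimal points is allowed.
\<close>

inductive adm_inner ::
    "('u \<Rightarrow> 'v \<Rightarrow> 'w \<Rightarrow> real) \<Rightarrow> 'u set \<Rightarrow> 'v set \<Rightarrow> 'w set \<Rightarrow> real \<Rightarrow>
     'u \<times> 'v \<times> 'w \<Rightarrow> 'u \<times> 'v \<times> 'w \<Rightarrow> bool"
  for J \<Sigma> V \<Gamma> \<epsilon> where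
  exit_uv:
    "\<lbrakk> near_optimal (\<epsilon> / 2) (\<Sigma> \<times> V) (\<lambda>(a, b). J a b w) (u', v');
       J u' v' w \<ge> J u v w - \<epsilon> / 2 \<rbrakk>
     \<Longrightarrow> adm_inner J \<Sigma> V \<Gamma> \<epsilon> (u, v, w) (u, v, w)"
| exit_w:
    "\<lbrakk> near_optimal (\<epsilon> / 2) (\<Sigma> \<times> V) (\<lambda>(a, b). J a b w) (u', v');
       \<not> J u' v' w \<ge> J u v w - \<epsilon> / 2;
       near_optimal (\<epsilon> / 2) \<Gamma> (\<lambda>c. J u' v' c) w';
       J u' v' w' \<ge> J u' v' w - \<epsilon> / 2 \<rbrakk>
     \<Longrightarrow> adm_inner J \<Sigma> V \<Gamma> \<epsilon> (u, v, w) (u', v', w)"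
| step:
    "\<lbrakk> near_optimal (\<epsilon> / 2) (\<Sigma> \<times> V) (\<lambda>(a, b). J a b w) (u', v');
       \<not> J u' v' w \<ge> J u v w - \<epsilon> / 2;
       near_optimal (\<epsilon> / 2) \<Gamma> (\<lambda>c. J u' v' c) w';
       \<not> J u' v' w' \<ge> J u' v' w - \<epsilon> / 2;
       adm_inner J \<Sigma> V \<Gamma> \<epsilon> (u', v', w') z \<rbrakk>
     \<Longrightarrow> adm_inner J \<Sigma> V \<Gamma> \<epsilon> (u, v, w) z"

text \<open>Index \<open>0\<close> is the initial point; \<open>\<rho> 0\<close> is not used.\<close>

definition penalty_adm_sequence ::
    "(real \<Rightarrow> 'u \<Rightarrow> 'v \<Rightarrow> 'w \<Rightarrow> real) \<Rightarrow> 'u set \<Rightarrow> 'v set \<Rightarrow> 'w set \<Rightarrow> real \<Rightarrow>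
     (nat \<Rightarrow> real) \<Rightarrow> (nat \<Rightarrow> 'u) \<Rightarrow> (nat \<Rightarrow> 'v) \<Rightarrow> (nat \<Rightarrow> 'w) \<Rightarrow> bool" where
  "penalty_adm_sequence J \<Sigma> V \<Gamma> \<epsilon> \<rho> u v w \<longleftrightarrow>
     (u 0, v 0, w 0) \<in> \<Sigma> \<times> V \<times> \<Gamma> \<and> \<rho> 1 = 0 \<and>
     (\<forall>k\<ge>1. adm_inner (J (\<rho> k)) \<Sigma> V \<Gamma> \<epsilon>
               (u (k - 1), v (k - 1), w (k - 1)) (u k, v k, w k) \<and>
            \<rho> k < \<rho> (k + 1))"

text \<open>Membership of the limit point in \<open>\<Sigma> \<times> V \<times> \<Gamma>\<close> is not part of the
  notion, since \<open>\<Sigma>\<close> and \<open>\<Gamma>\<close> need not be closed.\<close>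

definition p_minimum ::
    "('u \<Rightarrow> 'v \<Rightarrow> 'w \<Rightarrow> real) \<Rightarrow> 'u set \<Rightarrow> 'v set \<Rightarrow> 'w set \<Rightarrow> 'u \<Rightarrow> 'v \<Rightarrow> 'w \<Rightarrow> bool" where
  "p_minimum F \<Sigma> V \<Gamma> u v w \<longleftrightarrow>
     (\<forall>(a, b)\<in>\<Sigma> \<times> V. F a b w \<ge> F u v w) \<and> (\<forall>c\<in>\<Gamma>. F u v c \<ge> F u v w)"

end

theory Submission
  imports Defs
begin

text \<open>
  Write \<open>\<Psi>\<close> for the cost and \<open>\<chi>\<close> for the feasibility measure. The limit \<open>w\<^sup>*\<close> is a binary
  control, hence an admissible competitor for the unconstrained variable \<open>v\<close>. Since
  \<open>\<chi>(w\<^sup>*, w\<^sup>*) = 0\<close> and \<open>\<chi> \<ge> 0\<close>, both inequalities of a p-minimum follow as soon as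
  \<open>\<chi>(v\<^sup>*, w\<^sup>*) = 0\<close>, and this is what is shown.

  Whichever way the inner loop is left, the pair \<open>(u\<^sup>k, v\<^sup>k)\<close> is \<open>\<epsilon>\<close>-optimal for fixed
  \<open>w\<^sup>k\<close> (\<open>adm_inner_near_optimal\<close>), so that
  \<open>\<rho>\<^sup>k \<chi>(v\<^sup>k, w\<^sup>k) \<le> \<Psi>(a, b) - \<Psi>(u\<^sup>k, v\<^sup>k) + \<epsilon> + \<rho>\<^sup>k \<chi>(b, w\<^sup>k)\<close>
  for all admissible \<open>(a, b)\<close>. The term \<open>\<Psi>(u\<^sup>k, v\<^sup>k)\<close> has to be bounded below uniformly in
  \<open>k\<close>. Here the initial parameter \<open>\<rho>\<^sup>1 = 0\<close> helps: the first outer iteration minimizes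
  \<open>\<Psi>\<close> itself up to \<open>\<epsilon>\<close>, whence \<open>\<Psi>(u\<^sup>k, v\<^sup>k) \<ge> \<Psi>(u\<^sup>1, v\<^sup>1) - \<epsilon>\<close>
  (\<open>penalty_adm_infeasibility_bound\<close>). Taking \<open>a = u\<^sup>1\<close>, \<open>b = w\<^sup>*\<close> leaves a constant plus
  \<open>\<rho>\<^sup>k \<chi>(w\<^sup>*, w\<^sup>k)\<close> on the right.

  The passage to the limit is elementary because two binary vectors that differ have distance at
  least \<open>1\<close>: binary controls at \<open>L\<^sup>\<infinity>\<close> distance below \<open>1\<close> agree almost everywhere
  (\<open>binary_controls_AE_eq\<close>). So \<open>v\<^sup>k = v\<^sup>*\<close> and \<open>w\<^sup>k = w\<^sup>*\<close> almost everywhere for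
  large \<open>k\<close>, the estimate reads \<open>\<rho>\<^sup>k \<chi>(v\<^sup>*, w\<^sup>*) \<le> C\<close>, and \<open>\<rho>\<^sup>k \<rightarrow> \<infinity>\<close>
  forces \<open>\<chi>(v\<^sup>*, w\<^sup>*) \<le> 0\<close>.
\<close>

section \<open>Near-optimality of the outer iterates\<close>

text \<open>
  For a loop left in its first half step, the near-optimal pair that was found does not improve the
  current one by more than \<open>\<epsilon> / 2\<close>, so the tolerances add up to \<open>\<epsilon>\<close>. For a loop left
  in its second half step, the returned pair was computed for exactly the returned third component.
  The analogous property of the third component can fail: a loop that stops at once returns its
  starting point, whose third component was not optimized for the current objective.
\<close>

lemma adm_inner_near_optimal:
  assumes "adm_inner J \<Sigma> V \<Gamma> \<epsilon> (u, v, w) (u', v', w')"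
    and "(u, v, w) \<in> \<Sigma> \<times> V \<times> \<Gamma>" and "\<epsilon> \<ge> 0"
  shows "(u', v', w') \<in> \<Sigma> \<times> V \<times> \<Gamma>"
    and "near_optimal \<epsilon> (\<Sigma> \<times> V) (\<lambda>(a, b). J a b w') (u', v')"
proof -
  have "(u', v', w') \<in> \<Sigma> \<times> V \<times> \<Gamma> \<and>
      near_optimal \<epsilon> (\<Sigma> \<times> V) (\<lambda>(a, b). J a b w') (u', v')"
    using assms
  proof (induction "(u, v, w)" "(u', v', w')" arbitrary: u v w)
    case (exit_uv u1 v1)
    then show ?case
      by (force simp: near_optimal_def)
  next
    case (exit_w u v w2)
    then show ?case
      by (force simp: near_optimal_def)
  next
    case step
    then show ?case
      by (simp add: near_optimal_def)
  qed
  then show "(u', v', w') \<in> \<Sigma> \<times> V \<times> \<Gamma>"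
    and "near_optimal \<epsilon> (\<Sigma> \<times> V) (\<lambda>(a, b). J a b w') (u', v')"
    by blast+
qed

lemma penalty_adm_sequence_near_optimal:
  assumes "penalty_adm_sequence J \<Sigma> V \<Gamma> \<epsilon> \<rho> u v w" and "\<epsilon> \<ge> 0"
  shows penalty_adm_sequence_feasible: "(u k, v k, w k) \<in> \<Sigma> \<times> V \<times> \<Gamma>"
    and "k \<ge> 1 \<Longrightarrow> near_optimal \<epsilon> (\<Sigma> \<times> V) (\<lambda>(a, b). J (\<rho> k) a b (w k)) (u k, v k)"
proof -
  have inner: "adm_inner (J (\<rho> k)) \<Sigma> V \<Gamma> \<epsilon>
      (u (k - 1), v (k - 1), w (k - 1)) (u k, v k, w k)" if "k \<ge> 1" for k
    using assms that by (simp add: penalty_adm_sequence_def)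
  have feasible: "(u k, v k, w k) \<in> \<Sigma> \<times> V \<times> \<Gamma>" for k
  proof (induction k)
    case 0
    then show ?case
      using assms by (simp add: penalty_adm_sequence_def)
  next
    case (Suc k)
    then show ?case
      using adm_inner_near_optimal(1)[OF inner[of "Suc k"]] assms(2) by simp
  qed
  then show "(u k, v k, w k) \<in> \<Sigma> \<times> V \<times> \<Gamma>" .
  show "near_optimal \<epsilon> (\<Sigma> \<times> V) (\<lambda>(a, b). J (\<rho> k) a b (w k)) (u k, v k)" if "k \<ge> 1"
    using adm_inner_near_optimal(2)[OF inner[OF that] feasible assms(2)] .
qed

text \<open>
  One \<open>\<epsilon>\<close> is the tolerance in iteration \<open>k\<close>. The other one comes from the first
  iteration, where the penalty term vanishes, so that \<open>P (u 1) (v 1) - \<epsilon>\<close> is a lower bound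
  for \<open>P\<close> on \<open>\<Sigma> \<times> V\<close>.
\<close>

lemma penalty_adm_infeasibility_bound:
  fixes P :: "'u \<Rightarrow> 'v \<Rightarrow> real"
  assumes adm: "penalty_adm_sequence (\<lambda>r a b c. P a b + r * F b c) \<Sigma> V \<Gamma> \<epsilon> \<rho> u v w"
    and \<epsilon>: "\<epsilon> \<ge> 0" and k: "k \<ge> 1" and ab: "(a, b) \<in> \<Sigma> \<times> V"
  shows "\<rho> k * F (v k) (w k) \<le> P a b - P (u 1) (v 1) + 2 * \<epsilon> + \<rho> k * F b (w k)"
proof -
  have "\<rho> 1 = 0"
    using adm by (simp add: penalty_adm_sequence_def)
  then have "P (u 1) (v 1) \<le> P (u k) (v k) + \<epsilon>"
    using penalty_adm_sequence_near_optimal(2)[OF adm \<epsilon>, of 1]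
      penalty_adm_sequence_feasible[OF adm \<epsilon>, of k]
    by (auto simp: near_optimal_def)
  moreover have "P (u k) (v k) + \<rho> k * F (v k) (w k) \<le> P a b + \<rho> k * F b (w k) + \<epsilon>"
    using penalty_adm_sequence_near_optimal(2)[OF adm \<epsilon> k] ab
    by (auto simp: near_optimal_def)
  ultimately show ?thesis
    by linarith
qed

section \<open>Measurability of binary controls\<close>

lemma complete_measure_lebesgue_on:
  assumes "A \<in> sets lebesgue"
  shows "complete_measure (lebesgue_on A)"
proof
  fix B N
  assume "B \<subseteq> N" "N \<in> null_sets (lebesgue_on A)"
  moreover from this have "N \<in> null_sets lebesgue" "N \<subseteq> A"
    using assms null_sets_restrict_space[of A lebesgue] by auto
  ultimately have "B \<in> null_sets lebesgue" "B \<subseteq> A"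
    using completion.complete2[of B N lborel] by auto
  then show "B \<in> sets (lebesgue_on A)"
    using assms by (simp add: sets_restrict_space_iff null_setsD2)
qed

text \<open>
  The approximating simple functions converge only off a null set. Replacing them by zero there
  makes them converge everywhere, and completeness of the measure absorbs the change of the limit.
\<close>

lemma (in complete_measure) strongly_measurable_imp_borel_measurable:
  fixes g :: "'a \<Rightarrow> 'b::real_normed_vector"
  assumes "strongly_measurable M g"
  shows "g \<in> borel_measurable M"
proof -
  obtain s where s: "\<And>i::nat. simple_function M (s i)"
    and lim: "AE x in M. (\<lambda>i. s i x) \<longlonglongrightarrow> g x"
    using assms by (auto simp: strongly_measurable_def)
  define N where "N = {x \<in> space M. \<not> (\<lambda>i. s i x) \<longlonglongrightarrow> g x}"
  have N: "N \<in> null_sets M"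
    using lim unfolding AE_iff_null_sets N_def .
  define h where "h x = (if x \<in> N then 0 else g x)" for x
  have "h \<in> borel_measurable M"
  proof (rule borel_measurable_LIMSEQ_metric)
    have "simple_function M (\<lambda>x. if x \<in> N then 0 else s i x)" for i
      using s N by (intro simple_function_If_set) (auto simp: null_setsD2)
    then show "(\<lambda>x. if x \<in> N then 0 else s i x) \<in> borel_measurable M" for i
      by (rule borel_measurable_simple_function)
    show "(\<lambda>i. if x \<in> N then 0 else s i x) \<longlonglongrightarrow> h x" if "x \<in> space M" for x
      using that by (auto simp: h_def N_def)
  qed
  show ?thesis
  proof (rule measurableI)
    fix B :: "'b set"
    assume B: "B \<in> sets borel"
    have "AE x in M. x \<notin> N"
      using N by (rule AE_not_in)
    then have "AE x in M. x \<in> h -` B \<inter> space M \<longleftrightarrow> x \<in> g -` B \<inter> space M"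
      by eventually_elim (simp add: h_def)
    then show "g -` B \<inter> space M \<in> sets M"
      using measurable_sets[OF \<open>h \<in> borel_measurable M\<close> B] by (rule in_sets_AE) simp
  qed simp
qed

lemma binary_controlsD:
  assumes "v \<in> binary_controls T"
  shows "v \<in> borel_measurable (lebesgue_on {0<..<T})"
    and "AE t in lebesgue_on {0<..<T}. v t \<in> binary_vecs"
proof -
  interpret complete_measure "lebesgue_on {0<..<T}"
    by (rule complete_measure_lebesgue_on) simp
  show "v \<in> borel_measurable (lebesgue_on {0<..<T})"
    using assms
    by (intro strongly_measurable_imp_borel_measurable) (simp add: binary_controls_def Lp_space_def)
  show "AE t in lebesgue_on {0<..<T}. v t \<in> binary_vecs"
    using assms by (simp add: binary_controls_def)
qed

section \<open>Discreteness of binary controls\<close>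

lemma norm_diff_binary_vecs_le:
  fixes a b :: "real ^ 'm"
  assumes "a \<in> binary_vecs" "b \<in> binary_vecs"
  shows "norm (a - b) \<le> CARD('m)"
proof -
  have "\<bar>(a - b) $ i\<bar> \<le> 1" for i
  proof -
    have "a $ i \<in> {0, 1}" "b $ i \<in> {0, 1}"
      using assms by (simp_all add: binary_vecs_def)
    then show ?thesis
      by auto
  qed
  then have "(\<Sum>i\<in>UNIV. \<bar>(a - b) $ i\<bar>) \<le> (\<Sum>i\<in>(UNIV :: 'm set). 1)"
    by (intro sum_mono)
  then show ?thesis
    using norm_le_l1_cart[of "a - b"] by simp
qed

lemma binary_vecs_eqI:
  fixes a b :: "real ^ 'm"
  assumes "a \<in> binary_vecs" "b \<in> binary_vecs" "norm (a - b) < 1"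
  shows "a = b"
proof (rule vec_eq_iff[THEN iffD2], rule allI)
  fix i
  have "a $ i \<in> {0, 1}" "b $ i \<in> {0, 1}"
    using assms by (simp_all add: binary_vecs_def)
  moreover have "\<bar>a $ i - b $ i\<bar> < 1"
    using component_le_norm_cart[of "a - b" i] assms(3) by simp
  ultimately show "a $ i = b $ i"
    by auto
qed

lemma binary_controls_AE_eq:
  fixes v w :: "real \<Rightarrow> real ^ 'm"
  assumes v: "v \<in> binary_controls T" and w: "w \<in> binary_controls T"
    and less: "Lp_norm \<infinity> T (\<lambda>t. v t - w t) < 1"
  shows "AE t in lebesgue_on {0<..<T}. v t = w t"
proof -
  let ?M = "lebesgue_on {0<..<T}"
  define e where "e = esssup ?M (\<lambda>t. ennreal (norm (v t - w t)))"
  note [measurable] = binary_controlsD(1)[OF v] binary_controlsD(1)[OF w]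
  \<comment> \<open>Without this bound the norm would tell nothing about \<open>e\<close>, as \<open>enn2real \<infinity> = 0\<close>.\<close>
  have "e \<le> ennreal CARD('m)"
    unfolding e_def
  proof (rule esssup_I)
    show "AE t in ?M. ennreal (norm (v t - w t)) \<le> ennreal CARD('m)"
      using binary_controlsD(2)[OF v] binary_controlsD(2)[OF w]
      by eventually_elim (intro ennreal_leI norm_diff_binary_vecs_le)
  qed measurable
  then have "e < \<infinity>"
    by (simp add: order_le_less_trans)
  have "AE t in ?M. norm (v t - w t) < 1"
    using esssup_AE[where M = ?M and f = "\<lambda>t. ennreal (norm (v t - w t))"]
  proof eventually_elim
    case (elim t)
    then have "norm (v t - w t) \<le> enn2real e"
      using enn2real_mono[of "ennreal (norm (v t - w t))" e] \<open>e < \<infinity>\<close> by (simp add: e_def)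
    then show ?case
      using less by (simp add: Lp_norm_def e_def)
  qed
  then show ?thesis
    using binary_controlsD(2)[OF v] binary_controlsD(2)[OF w]
    by eventually_elim (rule binary_vecs_eqI)
qed

lemma Lp_tendsto_binary_controls_eventually_AE_eq:
  assumes "Lp_tendsto \<infinity> T v v'"
    and "\<And>k. v k \<in> binary_controls T" and "v' \<in> binary_controls T"
  shows "\<forall>\<^sub>F k in sequentially. AE t in lebesgue_on {0<..<T}. v k t = v' t"
proof -
  have "\<forall>\<^sub>F k in sequentially. Lp_norm \<infinity> T (\<lambda>t. v k t - v' t) < 1"
    using assms(1) unfolding Lp_tendsto_def by (rule order_tendstoD(2)) simp
  then show ?thesis
    by eventually_elim (rule binary_controls_AE_eq[OF assms(2,3)])
qed

section \<open>The feasibility measure\<close>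

lemma feas_measure_nonneg: "feas_measure T v w \<ge> 0"
  unfolding feas_measure_def l1_norm_def by (intro integral_nonneg_AE AE_I2 sum_nonneg) simp

lemma feas_measure_self: "feas_measure T v v = 0"
  by (simp add: feas_measure_def l1_norm_def)

lemma feas_measure_cong_AE:
  assumes "v \<in> binary_controls T" "v' \<in> binary_controls T"
    and "w \<in> binary_controls T" "w' \<in> binary_controls T"
    and v: "AE t in lebesgue_on {0<..<T}. v t = v' t"
    and w: "AE t in lebesgue_on {0<..<T}. w t = w' t"
  shows "feas_measure T v w = feas_measure T v' w'"
  unfolding feas_measure_def
proof (rule integral_cong_AE)
  note [measurable] = assms(1-4)[THEN binary_controlsD(1)]
  have [measurable]: "l1_norm \<in> borel_measurable (borel :: (real ^ 'm) measure)"
    unfolding l1_norm_def by (intro borel_measurable_continuous_onI continuous_intros)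
  show "(\<lambda>t. l1_norm (v t - w t)) \<in> borel_measurable (lebesgue_on {0<..<T})"
    and "(\<lambda>t. l1_norm (v' t - w' t)) \<in> borel_measurable (lebesgue_on {0<..<T})"
    by measurable
  show "AE t in lebesgue_on {0<..<T}. l1_norm (v t - w t) = l1_norm (v' t - w' t)"
    using v w by eventually_elim simp
qed

section \<open>Limits of the iterates\<close>

theorem theorem3:
  fixes T K \<epsilon> :: real
    and p :: ennreal
    and D :: "'y::banach set" and A :: "'y \<Rightarrow> 'y" and S :: "real \<Rightarrow> 'y \<Rightarrow> 'y"
    and f :: "'y \<Rightarrow> 'u::banach \<Rightarrow> real ^ 'm \<Rightarrow> 'y"
    and y0 :: 'y
    and \<Phi> :: "'y \<Rightarrow> real"
    and \<Sigma> :: "(real \<Rightarrow> 'u) set"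
    and \<Gamma> :: "(real \<Rightarrow> real ^ 'm) set"
    and \<rho> :: "nat \<Rightarrow> real"
    and u :: "nat \<Rightarrow> real \<Rightarrow> 'u" and u_star :: "real \<Rightarrow> 'u"
    and v w :: "nat \<Rightarrow> real \<Rightarrow> real ^ 'm" and v_star w_star :: "real \<Rightarrow> real ^ 'm"
  assumes "T > 0" and "p > 0"
    and "\<Sigma> \<subseteq> Lp_space p T" and "\<Gamma> \<subseteq> binary_controls T"
    and "densely_defined_linear D A" and "generates D A S"
    and "K > 0"
    and f_cont: "\<And>b. b \<in> binary_vecs \<Longrightarrow> continuous_on UNIV (\<lambda>(y, a). f y a b)"
    and f_growth: "\<And>b y a. b \<in> binary_vecs \<Longrightarrow> norm (f y a b) \<le> K * (1 + norm y)"
    and f_lipschitz: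
      "\<And>b y z a. b \<in> binary_vecs \<Longrightarrow> norm (f y a b - f z a b) \<le> K * norm (y - z)"
    and \<Phi>_lipschitz: "\<And>B. bounded B \<Longrightarrow> \<exists>L. L-lipschitz_on B \<Phi>"
    and "\<epsilon> \<ge> 0"
    and adm: "penalty_adm_sequence (penalty_cost T S f y0 \<Phi>) \<Sigma> (binary_controls T) \<Gamma> \<epsilon> \<rho> u v w"
    and \<rho>_lim: "filterlim \<rho> at_top sequentially"
    and "u_star \<in> Lp_space p T" and "v_star \<in> binary_controls T" and "w_star \<in> binary_controls T"
    and "Lp_tendsto p T u u_star" and "Lp_tendsto \<infinity> T v v_star" and "Lp_tendsto \<infinity> T w w_star"
  shows "p_minimum (\<lambda>_ b c. feas_measure T b c) \<Sigma> (binary_controls T) \<Gamma> u_star v_star w_star"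
proof -
  let ?V = "binary_controls T :: (real \<Rightarrow> real ^ 'm) set"
  let ?F = "feas_measure T :: (real \<Rightarrow> real ^ 'm) \<Rightarrow> (real \<Rightarrow> real ^ 'm) \<Rightarrow> real"
  let ?\<Psi> = "cost T S f y0 \<Phi>"
  note adm' = adm[unfolded penalty_cost_def[abs_def]]
  have feasible: "u k \<in> \<Sigma>" "v k \<in> ?V" "w k \<in> ?V" for k
    using penalty_adm_sequence_feasible[OF adm \<open>\<epsilon> \<ge> 0\<close>, of k] \<open>\<Gamma> \<subseteq> ?V\<close> by auto
  define C where "C = ?\<Psi> (u 1) w_star - ?\<Psi> (u 1) (v 1) + 2 * \<epsilon>"
  have bound: "\<forall>\<^sub>F k in sequentially. \<rho> k * ?F v_star w_star \<le> C"
    using Lp_tendsto_binary_controls_eventually_AE_eq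
        [OF \<open>Lp_tendsto \<infinity> T v v_star\<close> feasible(2) \<open>v_star \<in> ?V\<close>]
      Lp_tendsto_binary_controls_eventually_AE_eq
        [OF \<open>Lp_tendsto \<infinity> T w w_star\<close> feasible(3) \<open>w_star \<in> ?V\<close>]
      eventually_ge_at_top[of 1]
  proof eventually_elim
    case (elim k)
    have "\<rho> k * ?F (v k) (w k) \<le> C + \<rho> k * ?F w_star (w k)"
      using penalty_adm_infeasibility_bound[OF adm' \<open>\<epsilon> \<ge> 0\<close> elim(3), of "u 1" w_star]
        feasible(1)[of 1] \<open>w_star \<in> ?V\<close>
      by (simp add: C_def)
    moreover have "?F (v k) (w k) = ?F v_star w_star"
      using feasible \<open>v_star \<in> ?V\<close> \<open>w_star \<in> ?V\<close> elim by (intro feas_measure_cong_AE)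
    moreover have "?F w_star (w k) = ?F w_star w_star"
      using feasible \<open>w_star \<in> ?V\<close> elim by (intro feas_measure_cong_AE) auto
    ultimately show ?case
      by (simp add: feas_measure_self)
  qed
  have "?F v_star w_star \<le> 0"
  proof (rule ccontr)
    assume "\<not> ?F v_star w_star \<le> 0"
    then have "filterlim (\<lambda>k. ?F v_star w_star * \<rho> k) at_top sequentially"
      by (intro filterlim_tendsto_pos_mult_at_top[OF tendsto_const _ \<rho>_lim]) simp
    then have "\<forall>\<^sub>F k in sequentially. C < ?F v_star w_star * \<rho> k"
      by (simp add: filterlim_at_top_dense)
    with bound have "\<forall>\<^sub>F k :: nat in sequentially. False"
      by eventually_elim (simp add: mult.commute)
    then show False
      by simp
  qed
  then show ?thesis
    unfolding p_minimum_def using feas_measure_nonneg by (auto intro: order_trans)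
qed

end
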